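(* Let $A_1,\dots,A_n\in\mathbb{R}^{p\times p}$ be symmetric matrices for which there exist constants $\lambda,\eta>0$ with $$\lambda\|u\|^2\|v\|^2\le \frac1n\sum_{i=1}^n\langle u,A_iv\rangle^2\le \eta\|u\|^2\|v\|^2\qquad\text{for all }u,v\in\mathbb{R}^p .$$ Let $x^*\in\mathbb{R}^p$, $x^*\neq 0$, let $b_i=\langle x^*,A_ix^*\rangle+\varepsilon_i$ for $i=1,\dots,n$, and let $\hat x$ be a global minimizer over $\mathbb{R}^p$ of $f(x)=\frac{1}{4n}\sum_{i=1}^n(\langle x,A_ix\rangle-b_i)^2$. (Noiseless case) If $\varepsilon_i=0$ for all $i$, then $\hat x=x^*$ or $\hat x=-x^*$. (Noisy case) If $\varepsilon_1,\dots,\varepsilon_n$ are i.i.d. sub-Gaussian random variables with variance proxy $\varsigma^2>0$, mean zero and positive variance $\mathbb{E}\varepsilon_1^2$, then with probability at least $1-p_1-p_2$, $$\min\{\|\hat x-x^*\|,\|\hat x+x^*\|\}\le \frac{4}{\lambda\|x^*\|}\sqrt{\frac{6\varsigma^2\eta\, p\log(1+2n)}{n}},$$ where $p_1=2\exp\{-p\log(1+2n)\}$ and $p_2=2\exp\{-\frac{n\,\mathbb{E}\varepsilon_1^2}{512\,\varsigma^2}\}$.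
   Context: $\|\cdot\|$ is the Euclidean norm of a vector. The matrices $A_i$ and the signal $x^*$ are deterministic; the only randomness is in the noise $\varepsilon_i$. A real random variable $X$ is sub-Gaussian with variance proxy $\varrho^2$ if $\mathbb{E}X=0$ and $\mathbb{E}\exp(sX)\le\exp(\varrho^2s^2/2)$ for all $s\in\mathbb{R}$. *)

theory Defs
  imports "HOL-Probability.Probability"
begin

text \<open>The parameter \<open>v\<close> is the variance proxy itself, not its square root. The integrability
  conditions make the expectations meaningful, since the Bochner integral of a non-integrable
  function is \<open>0\<close>.\<close>

definition sub_gaussian :: "'w measure \<Rightarrow> ('w \<Rightarrow> real) \<Rightarrow> real \<Rightarrow> bool" where
  "sub_gaussian M X v \<longleftrightarrow>
     integrable M X \<and> (\<integral>\<omega>. X \<omega> \<partial>M) = 0 \<and>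
     (\<forall>s::real. integrable M (\<lambda>\<omega>. exp (s * X \<omega>)) \<and>
        (\<integral>\<omega>. exp (s * X \<omega>) \<partial>M) \<le> exp (v * s\<^sup>2 / 2))"

definition observations ::
    "(nat \<Rightarrow> real^'p^'p) \<Rightarrow> real^'p \<Rightarrow> (nat \<Rightarrow> real) \<Rightarrow> nat \<Rightarrow> real" where
  "observations A xstar e i = xstar \<bullet> (A i *v xstar) + e i"

definition objective ::
    "nat \<Rightarrow> (nat \<Rightarrow> real^'p^'p) \<Rightarrow> (nat \<Rightarrow> real) \<Rightarrow> real^'p \<Rightarrow> real" where
  "objective n A b x = 1 / (4 * real n) * (\<Sum>i=1..n. (x \<bullet> (A i *v x) - b i)\<^sup>2)"

end

theory Submission
  imports Defs
begin

text \<open>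
  Write \<open>u = xhat - xstar\<close> and \<open>v = xhat + xstar\<close>. Since every \<open>A i\<close> is symmetric, the difference
  of the two quadratic forms at \<open>xhat\<close> and \<open>xstar\<close> is the bilinear expression \<open>u \<bullet> (A i *v v)\<close>, so
  comparing the objective at \<open>xhat\<close> with its value at \<open>xstar\<close> gives the basic inequality
  \<open>(\<Sum>i. (u \<bullet> (A i *v v))\<^sup>2) \<le> 2 * (\<Sum>i. eps i * (u \<bullet> (A i *v v)))\<close>. The left side is at least
  \<open>n * lam * (norm u)\<^sup>2 * (norm v)\<^sup>2\<close>. Without noise this forces \<open>u = 0\<close> or \<open>v = 0\<close>. With noise,
  a bound \<open>s * norm u * norm v\<close> for the noise form on the right yields
  \<open>norm u * norm v \<le> 2 * s / (n * lam)\<close>; as \<open>norm u + norm v \<ge> 2 * norm xstar\<close>, the larger of the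
  two norms is at least \<open>norm xstar\<close>, and the smaller one is controlled.

  It remains to show that, with \<open>p = CARD('p)\<close>, the noise form is bounded by
  \<open>s = 2 * sqrt (6 * sig\<^sup>2 * eta * p * n * ln (1 + 2 * n))\<close>
  with probability at least \<open>1 - 2 * exp (- p * ln (1 + 2 * n))\<close>.

  For \<open>n \<ge> 4\<close>, take a \<open>1/4\<close>-net of the unit sphere with at most \<open>9 ^ p \<le> (1 + 2 * n) ^ p\<close> points.
  For a fixed pair of net points the noise form is a linear combination of independent
  sub-Gaussian variables with squared coefficients summing to at most \<open>n * eta\<close>, so a Chernoff
  bound and a union bound over the pairs give the bound \<open>s / 2\<close> on the net; passing from the net to
  the sphere loses a factor of \<open>2\<close>.

  For \<open>n \<le> 3\<close> the bound \<open>9 ^ p\<close> on the size of the net exceeds \<open>(1 + 2 * n) ^ p\<close>. But then there are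
  so few noise variables that a union bound over them controls each \<open>eps i\<close>, and the Cauchy-Schwarz
  inequality transfers this to the noise form.
\<close>

section \<open>Nets of the unit sphere and bilinear forms\<close>

text \<open>Balls of radius \<open>d / 2\<close> around \<open>d\<close>-separated points of the unit sphere are disjoint and lie in
  the ball of radius \<open>1 + d / 2\<close>; compare volumes.\<close>

lemma card_separated_sphere_le:
  fixes N :: "'a::euclidean_space set"
  assumes "0 < d" "finite N" "N \<subseteq> sphere 0 1"
    and sep: "\<And>x y. x \<in> N \<Longrightarrow> y \<in> N \<Longrightarrow> x \<noteq> y \<Longrightarrow> d \<le> dist x y"
  shows "real (card N) \<le> (1 + 2 / d) ^ DIM('a)"
proof -
  let ?V = "unit_ball_vol (real DIM('a))"
  have disj: "disjoint_family_on (\<lambda>x. ball x (d / 2)) N"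
    unfolding disjoint_family_on_def
  proof (intro ballI impI, rule ccontr)
    fix x y assume xy: "x \<in> N" "y \<in> N" "x \<noteq> y" and "ball x (d / 2) \<inter> ball y (d / 2) \<noteq> {}"
    then obtain z where "dist x z < d / 2" "dist y z < d / 2" by auto
    with dist_triangle2[of x y z] sep[OF xy] show False by linarith
  qed
  have "real (card N) * (?V * (d / 2) ^ DIM('a)) = (\<Sum>x\<in>N. measure lborel (ball x (d / 2)))"
    using assms by (simp add: content_ball)
  also have "\<dots> = measure lborel (\<Union>x\<in>N. ball x (d / 2))"
    by (rule measure_finite_Union[symmetric]) (use assms disj emeasure_lborel_ball_finite in \<open>auto simp: less_top\<close>)
  also have "\<dots> \<le> measure lborel (ball (0::'a) (1 + d / 2))"
  proof (rule measure_mono_fmeasurable)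
    show "(\<Union>x\<in>N. ball x (d / 2)) \<subseteq> ball (0::'a) (1 + d / 2)"
    proof
      fix z assume "z \<in> (\<Union>x\<in>N. ball x (d / 2))"
      then obtain x where "x \<in> N" "dist x z < d / 2" by auto
      with assms(3) have "norm x = 1" by auto
      with dist_triangle[of 0 z x] \<open>dist x z < d / 2\<close> show "z \<in> ball 0 (1 + d / 2)"
        by simp
    qed
    show "(\<Union>x\<in>N. ball x (d / 2)) \<in> sets lborel"
      by (simp add: borel_open open_UN)
    show "ball (0::'a) (1 + d / 2) \<in> fmeasurable lborel"
      using emeasure_lborel_ball_finite[of "0::'a" "1 + d / 2"] by (simp add: fmeasurable_def less_top)
  qed
  also have "\<dots> = ?V * (1 + d / 2) ^ DIM('a)"
    using assms by (simp add: content_ball)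
  finally have "?V * (real (card N) * (d / 2) ^ DIM('a)) \<le> ?V * (1 + d / 2) ^ DIM('a)"
    by (simp add: mult_ac)
  then have "real (card N) * (d / 2) ^ DIM('a) \<le> (1 + d / 2) ^ DIM('a)"
    by (subst (asm) mult_le_cancel_left_pos) auto
  then have "real (card N) \<le> (1 + d / 2) ^ DIM('a) / (d / 2) ^ DIM('a)"
    using assms by (simp add: pos_le_divide_eq)
  also have "\<dots> = ((1 + d / 2) / (d / 2)) ^ DIM('a)"
    by (simp only: power_divide)
  also have "(1 + d / 2) / (d / 2) = 1 + 2 / d"
    using assms by (simp add: field_simps)
  finally show ?thesis .
qed

text \<open>A separated set of largest cardinality is a net, since any point far from all of it could be
  added.\<close>

lemma sphere_net_exists:
  assumes "0 < d"
  obtains N :: "'a::euclidean_space set" where "finite N" "N \<subseteq> sphere 0 1"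
    "real (card N) \<le> (1 + 2 / d) ^ DIM('a)"
    "\<And>x. norm x = 1 \<Longrightarrow> \<exists>y\<in>N. dist x y < d"
proof -
  define P where "P N \<longleftrightarrow>
    finite N \<and> N \<subseteq> sphere 0 1 \<and> (\<forall>x\<in>N. \<forall>y\<in>N. x \<noteq> y \<longrightarrow> d \<le> dist x y)" for N :: "'a set"
  have bound: "real (card N) \<le> (1 + 2 / d) ^ DIM('a)" if "P N" for N
    using card_separated_sphere_le[OF assms, of N] that unfolding P_def by blast
  have "\<forall>N. P N \<longrightarrow> card N < Suc (nat \<lfloor>(1 + 2 / d) ^ DIM('a)\<rfloor>)"
    using bound by (simp add: less_Suc_eq_le le_nat_floor)
  moreover have "P {}" by (simp add: P_def)
  ultimately have "\<exists>N. P N \<and> (\<forall>N'. P N' \<longrightarrow> card N' \<le> card N)"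
    by (rule ex_has_greatest_nat[rotated])
  then obtain N where N: "P N" and max: "\<And>N'. P N' \<Longrightarrow> card N' \<le> card N"
    by blast
  have "\<exists>y\<in>N. dist x y < d" if x: "norm x = 1" for x
  proof (rule ccontr)
    assume "\<not> (\<exists>y\<in>N. dist x y < d)"
    then have far: "\<forall>y\<in>N. d \<le> dist x y" by force
    then have "x \<notin> N" using assms by force
    moreover have "P (insert x N)"
      using N far x by (auto simp: P_def dist_commute)
    ultimately show False
      using max[of "insert x N"] N by (simp add: P_def)
  qed
  with N bound[OF N] show ?thesis
    unfolding P_def by (intro that[of N]) auto
qed

text \<open>Moving both arguments of the form to net points changes its value by at most half of the
  supremum over pairs of unit vectors, so this supremum \<open>S\<close> satisfies \<open>S \<le> t + S / 2\<close>.\<close>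

lemma bilinear_le_of_net:
  fixes g :: "'a::euclidean_space \<Rightarrow> 'a \<Rightarrow> real"
  assumes bil: "bounded_bilinear g" and N: "N \<subseteq> sphere 0 1"
    and net: "\<And>x. norm x = 1 \<Longrightarrow> \<exists>y\<in>N. dist x y < 1 / 4"
    and t: "\<And>x y. x \<in> N \<Longrightarrow> y \<in> N \<Longrightarrow> \<bar>g x y\<bar> \<le> t"
  shows "\<bar>g u v\<bar> \<le> 2 * t * norm u * norm v"
proof -
  interpret bounded_bilinear g by fact
  let ?U = "sphere (0::'a) 1 \<times> sphere (0::'a) 1"
  define S where "S = (SUP (x, y) \<in> ?U. \<bar>g x y\<bar>)"
  obtain K where K: "\<And>x y. norm (g x y) \<le> norm x * norm y * K"
    using bounded by blast
  have "\<bar>g x y\<bar> \<le> K" if "norm x = 1" "norm y = 1" for x y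
    using K[of x y] that by simp
  then have bdd: "bdd_above ((\<lambda>(x, y). \<bar>g x y\<bar>) ` ?U)"
    by (intro bdd_aboveI[of _ K]) auto
  have le_S: "\<bar>g x y\<bar> \<le> S" if "norm x = 1" "norm y = 1" for x y
    using cSUP_upper[OF _ bdd, of "(x, y)"] that by (simp add: S_def)
  have gen: "\<bar>g x y\<bar> \<le> S * norm x * norm y" for x y
  proof (cases "x = 0 \<or> y = 0")
    case True
    then show ?thesis by (auto simp: zero_left zero_right)
  next
    case False
    have "\<bar>g x y\<bar> = norm x * norm y * \<bar>g (x /\<^sub>R norm x) (y /\<^sub>R norm y)\<bar>"
      using False by (simp add: scaleR_left scaleR_right abs_mult field_simps)
    also have "\<dots> \<le> norm x * norm y * S"
      by (intro mult_left_mono le_S) (use False in auto)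
    finally show ?thesis by (simp add: mult_ac)
  qed
  obtain b :: 'a where "b \<in> Basis" using nonempty_Basis by blast
  then have "norm b = 1" by simp
  then have ne: "?U \<noteq> {}" by auto
  have "0 \<le> S"
    using le_S[OF \<open>norm b = 1\<close> \<open>norm b = 1\<close>] by linarith
  have "S \<le> t + S / 2"
    unfolding S_def
  proof (rule cSUP_least[OF ne], unfold S_def[symmetric])
    fix p assume "p \<in> ?U"
    then obtain x y where p: "p = (x, y)" and n: "norm x = 1" "norm y = 1" by auto
    obtain x' y' where x': "x' \<in> N" "dist x x' < 1 / 4" and y': "y' \<in> N" "dist y y' < 1 / 4"
      using net n by blast
    have "norm y' = 1" using N y' by auto
    have "g x y = g x' y' + g (x - x') y' + g x (y - y')"
      by (simp add: diff_left diff_right)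
    also have "\<bar>\<dots>\<bar> \<le> \<bar>g x' y'\<bar> + \<bar>g (x - x') y'\<bar> + \<bar>g x (y - y')\<bar>"
      by linarith
    also have "\<dots> \<le> t + S * (1 / 4) + S * (1 / 4)"
    proof (intro add_mono t x' y')
      show "\<bar>g (x - x') y'\<bar> \<le> S * (1 / 4)"
        using gen[of "x - x'" y'] mult_left_mono[OF less_imp_le[OF x'(2)] \<open>0 \<le> S\<close>] \<open>norm y' = 1\<close>
        by (simp add: dist_norm)
      show "\<bar>g x (y - y')\<bar> \<le> S * (1 / 4)"
        using gen[of x "y - y'"] mult_left_mono[OF less_imp_le[OF y'(2)] \<open>0 \<le> S\<close>] n
        by (simp add: dist_norm)
    qed
    finally show "(case p of (x, y) \<Rightarrow> \<bar>g x y\<bar>) \<le> t + S / 2"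
      by (simp add: p)
  qed
  then have "S * norm u * norm v \<le> 2 * t * norm u * norm v"
    by (intro mult_right_mono) auto
  with gen[of u v] show ?thesis by linarith
qed

section \<open>Tails of linear combinations of sub-Gaussian variables\<close>

lemma sub_gaussian_mono:
  assumes "sub_gaussian M X v" "v \<le> w"
  shows "sub_gaussian M X w"
proof -
  have "exp (v * s\<^sup>2 / 2) \<le> exp (w * s\<^sup>2 / 2)" for s :: real
    using assms(2) by (simp add: mult_right_mono)
  with assms(1) show ?thesis
    unfolding sub_gaussian_def by (meson order_trans)
qed

lemma sub_gaussian_uminus:
  assumes "sub_gaussian M X v"
  shows "sub_gaussian M (\<lambda>\<omega>. - X \<omega>) v"
  unfolding sub_gaussian_def
proof (intro conjI allI)
  fix s :: real
  have "integrable M (\<lambda>\<omega>. exp ((- s) * X \<omega>)) \<and>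
      (\<integral>\<omega>. exp ((- s) * X \<omega>) \<partial>M) \<le> exp (v * (- s)\<^sup>2 / 2)"
    using assms unfolding sub_gaussian_def by blast
  then show "integrable M (\<lambda>\<omega>. exp (s * - X \<omega>))"
    and "(\<integral>\<omega>. exp (s * - X \<omega>) \<partial>M) \<le> exp (v * s\<^sup>2 / 2)" by simp_all
qed (use assms in \<open>auto simp: sub_gaussian_def\<close>)

text \<open>By independence the moment generating function of the sum is the product of those of its
  terms, so the quadratic exponents add up.\<close>

lemma (in prob_space) sub_gaussian_linear_combination:
  fixes c :: "'i \<Rightarrow> real"
  assumes "finite I" and indep: "indep_vars (\<lambda>_. borel) X I"
    and sg: "\<And>i. i \<in> I \<Longrightarrow> sub_gaussian M (X i) v"
  shows "sub_gaussian M (\<lambda>\<omega>. \<Sum>i\<in>I. c i * X i \<omega>) (v * (\<Sum>i\<in>I. (c i)\<^sup>2))"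
  unfolding sub_gaussian_def
proof (intro conjI allI)
  have int: "integrable M (X i)" and zero: "expectation (X i) = 0" if "i \<in> I" for i
    using sg[OF that] by (auto simp: sub_gaussian_def)
  show "integrable M (\<lambda>\<omega>. \<Sum>i\<in>I. c i * X i \<omega>)"
    using int by auto
  show "(\<integral>\<omega>. (\<Sum>i\<in>I. c i * X i \<omega>) \<partial>M) = 0"
    using int zero by (subst Bochner_Integration.integral_sum) auto
next
  fix s :: real
  have exp_lin: "exp (s * (\<Sum>i\<in>I. c i * X i \<omega>)) = (\<Prod>i\<in>I. exp ((s * c i) * X i \<omega>))" for \<omega>
    using \<open>finite I\<close> by (simp add: exp_sum sum_distrib_left mult_ac)
  have mgf: "integrable M (\<lambda>\<omega>. exp ((s * c i) * X i \<omega>))"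
    "expectation (\<lambda>\<omega>. exp ((s * c i) * X i \<omega>)) \<le> exp (v * (s * c i)\<^sup>2 / 2)" if "i \<in> I" for i
    using sg[OF that] unfolding sub_gaussian_def by blast+
  have ind: "indep_vars (\<lambda>_. borel) (\<lambda>i \<omega>. exp ((s * c i) * X i \<omega>)) I"
    by (rule indep_vars_compose2[OF indep]) measurable
  show "integrable M (\<lambda>\<omega>. exp (s * (\<Sum>i\<in>I. c i * X i \<omega>)))"
    unfolding exp_lin by (rule indep_vars_integrable[OF \<open>finite I\<close> ind mgf(1)])
  have "expectation (\<lambda>\<omega>. exp (s * (\<Sum>i\<in>I. c i * X i \<omega>)))
      = (\<Prod>i\<in>I. expectation (\<lambda>\<omega>. exp ((s * c i) * X i \<omega>)))"
    unfolding exp_lin by (rule indep_vars_lebesgue_integral[OF \<open>finite I\<close> ind mgf(1)])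
  also have "\<dots> \<le> (\<Prod>i\<in>I. exp (v * (s * c i)\<^sup>2 / 2))"
    by (intro prod_mono conjI mgf(2)) auto
  also have "\<dots> = exp (v * (\<Sum>i\<in>I. (c i)\<^sup>2) * s\<^sup>2 / 2)"
    using \<open>finite I\<close>
    by (simp add: exp_sum[symmetric] sum_distrib_left sum_distrib_right
        sum_divide_distrib power_mult_distrib mult_ac)
  finally show "(\<integral>\<omega>. exp (s * (\<Sum>i\<in>I. c i * X i \<omega>)) \<partial>M)
    \<le> exp (v * (\<Sum>i\<in>I. (c i)\<^sup>2) * s\<^sup>2 / 2)" .
qed

text \<open>Chernoff's method: Markov's inequality for \<open>exp (s * X)\<close> with the optimal \<open>s = t / v\<close>.\<close>

lemma (in prob_space) sub_gaussian_upper_tail: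
  assumes sg: "sub_gaussian M X v" and "0 < v" "0 \<le> t"
  shows "prob {\<omega> \<in> space M. t \<le> X \<omega>} \<le> exp (- (t\<^sup>2 / (2 * v)))"
proof (cases "t = 0")
  case True
  then show ?thesis by simp
next
  case False
  with \<open>0 \<le> t\<close> have "0 < t" by simp
  define s where "s = t / v"
  have "0 < s" using \<open>0 < t\<close> \<open>0 < v\<close> by (simp add: s_def)
  have mgf: "integrable M (\<lambda>\<omega>. exp (s * X \<omega>))" "expectation (\<lambda>\<omega>. exp (s * X \<omega>)) \<le> exp (v * s\<^sup>2 / 2)"
    using sg unfolding sub_gaussian_def by blast+
  have "{\<omega> \<in> space M. t \<le> X \<omega>} = {\<omega> \<in> space M. exp (s * t) \<le> exp (s * X \<omega>)}"
    using \<open>0 < s\<close> by simp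
  also have "prob \<dots> \<le> expectation (\<lambda>\<omega>. exp (s * X \<omega>)) / exp (s * t)"
    by (rule integral_Markov_inequality_measure[where A = "{}"]) (use mgf in auto)
  also have "\<dots> \<le> exp (v * s\<^sup>2 / 2) / exp (s * t)"
    using mgf by (simp add: divide_right_mono)
  also have "\<dots> = exp (- (t\<^sup>2 / (2 * v)))"
    using \<open>0 < v\<close> unfolding exp_diff[symmetric] by (simp add: s_def field_simps power2_eq_square)
  finally show ?thesis .
qed

lemma (in prob_space) sub_gaussian_abs_tail:
  assumes sg: "sub_gaussian M X v" and "0 < v" "0 \<le> t"
  shows "prob {\<omega> \<in> space M. t < \<bar>X \<omega>\<bar>} \<le> 2 * exp (- (t\<^sup>2 / (2 * v)))"
proof -
  have [measurable]: "X \<in> borel_measurable M"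
    using sg by (auto simp: sub_gaussian_def)
  have "prob {\<omega> \<in> space M. t < \<bar>X \<omega>\<bar>}
      \<le> prob ({\<omega> \<in> space M. t \<le> X \<omega>} \<union> {\<omega> \<in> space M. t \<le> - X \<omega>})"
    by (rule finite_measure_mono) auto
  also have "\<dots> \<le> prob {\<omega> \<in> space M. t \<le> X \<omega>} + prob {\<omega> \<in> space M. t \<le> - X \<omega>}"
    by (rule measure_Un_le) measurable
  finally show ?thesis
    using sub_gaussian_upper_tail[OF assms]
      sub_gaussian_upper_tail[OF sub_gaussian_uminus[OF sg] assms(2,3)] by linarith
qed

lemma (in prob_space) sub_gaussian_union_bound:
  assumes "finite J" and sg: "\<And>j. j \<in> J \<Longrightarrow> sub_gaussian M (Z j) v" and "0 < v" "0 \<le> t"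
  shows "{\<omega> \<in> space M. \<forall>j\<in>J. \<bar>Z j \<omega>\<bar> \<le> t} \<in> events"
    and "1 - real (card J) * (2 * exp (- (t\<^sup>2 / (2 * v)))) \<le> prob {\<omega> \<in> space M. \<forall>j\<in>J. \<bar>Z j \<omega>\<bar> \<le> t}"
proof -
  have [measurable]: "Z j \<in> borel_measurable M" if "j \<in> J" for j
    using sg[OF that] by (auto simp: sub_gaussian_def)
  show ev: "{\<omega> \<in> space M. \<forall>j\<in>J. \<bar>Z j \<omega>\<bar> \<le> t} \<in> events"
    using \<open>finite J\<close> by measurable
  have "space M - {\<omega> \<in> space M. \<forall>j\<in>J. \<bar>Z j \<omega>\<bar> \<le> t} = (\<Union>j\<in>J. {\<omega> \<in> space M. t < \<bar>Z j \<omega>\<bar>})"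
    by (auto simp: not_le)
  then have "1 - prob {\<omega> \<in> space M. \<forall>j\<in>J. \<bar>Z j \<omega>\<bar> \<le> t}
      = prob (\<Union>j\<in>J. {\<omega> \<in> space M. t < \<bar>Z j \<omega>\<bar>})"
    using prob_compl[OF ev] by simp
  also have "\<dots> \<le> (\<Sum>j\<in>J. prob {\<omega> \<in> space M. t < \<bar>Z j \<omega>\<bar>})"
    by (rule measure_UNION_le[OF \<open>finite J\<close>]) measurable
  also have "\<dots> \<le> (\<Sum>j\<in>J. 2 * exp (- (t\<^sup>2 / (2 * v))))"
    by (intro sum_mono sub_gaussian_abs_tail sg \<open>0 < v\<close> \<open>0 \<le> t\<close>)
  finally show "1 - real (card J) * (2 * exp (- (t\<^sup>2 / (2 * v))))
      \<le> prob {\<omega> \<in> space M. \<forall>j\<in>J. \<bar>Z j \<omega>\<bar> \<le> t}" by simp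
qed

section \<open>Deterministic consequences of optimality\<close>

lemma quadratic_form_diff:
  fixes B :: "real^'p^'p"
  assumes "transpose B = B"
  shows "x \<bullet> (B *v x) - y \<bullet> (B *v y) = (x - y) \<bullet> (B *v (x + y))"
proof -
  have "y \<bullet> (B *v x) = x \<bullet> (B *v y)"
    by (metis assms dot_lmul_matrix inner_commute transpose_matrix_vector)
  then show ?thesis
    by (simp add: matrix_vector_right_distrib inner_diff_left inner_add_right)
qed

lemma minimizer_basic_inequality:
  fixes A :: "nat \<Rightarrow> real^'p^'p"
  assumes "1 \<le> n" and sym: "\<And>i. i \<in> {1..n} \<Longrightarrow> transpose (A i) = A i"
    and min: "is_arg_min (objective n A (observations A xstar eps)) (\<lambda>_. True) xhat"
  shows "(\<Sum>i=1..n. ((xhat - xstar) \<bullet> (A i *v (xhat + xstar)))\<^sup>2)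
    \<le> 2 * (\<Sum>i=1..n. eps i * ((xhat - xstar) \<bullet> (A i *v (xhat + xstar))))"
proof -
  define q where "q i = (xhat - xstar) \<bullet> (A i *v (xhat + xstar))" for i
  have res: "xhat \<bullet> (A i *v xhat) - observations A xstar eps i = q i - eps i"
    if "i \<in> {1..n}" for i
    using quadratic_form_diff[OF sym[OF that], of xhat xstar] by (simp add: observations_def q_def)
  have "objective n A (observations A xstar eps) xhat \<le> objective n A (observations A xstar eps) xstar"
    using min by (auto simp: is_arg_min_def not_less)
  then have "(\<Sum>i=1..n. (xhat \<bullet> (A i *v xhat) - observations A xstar eps i)\<^sup>2)
      \<le> (\<Sum>i=1..n. (xstar \<bullet> (A i *v xstar) - observations A xstar eps i)\<^sup>2)"
    using \<open>1 \<le> n\<close> by (simp add: objective_def divide_le_cancel)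
  also have "\<dots> = (\<Sum>i=1..n. (eps i)\<^sup>2)"
    by (simp add: observations_def)
  also have "(\<Sum>i=1..n. (xhat \<bullet> (A i *v xhat) - observations A xstar eps i)\<^sup>2)
      = (\<Sum>i=1..n. (q i - eps i)\<^sup>2)"
    using res by (intro sum.cong) auto
  also have "\<dots> = (\<Sum>i=1..n. (q i)\<^sup>2) - 2 * (\<Sum>i=1..n. eps i * q i) + (\<Sum>i=1..n. (eps i)\<^sup>2)"
    by (simp add: power2_diff sum.distrib sum_subtractf sum_distrib_left mult_ac)
  finally show ?thesis by (simp add: q_def)
qed

text \<open>The two distances multiply to at most \<open>2 * s / (lam * n)\<close>, and the larger one is at least
  \<open>norm xstar\<close> because \<open>(xhat + xstar) - (xhat - xstar) = 2 *\<^sub>R xstar\<close>. The noiseless case is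
  \<open>s = 0\<close>.\<close>

lemma minimizer_error_le:
  fixes A :: "nat \<Rightarrow> real^'p^'p"
  assumes "1 \<le> n" "0 < lam" "xstar \<noteq> 0" "0 \<le> s"
    and sym: "\<And>i. i \<in> {1..n} \<Longrightarrow> transpose (A i) = A i"
    and lower: "\<And>u v. lam * (norm u)\<^sup>2 * (norm v)\<^sup>2 \<le> 1 / real n * (\<Sum>i=1..n. (u \<bullet> (A i *v v))\<^sup>2)"
    and min: "is_arg_min (objective n A (observations A xstar eps)) (\<lambda>_. True) xhat"
    and noise: "\<And>u v. \<bar>\<Sum>i=1..n. eps i * (u \<bullet> (A i *v v))\<bar> \<le> s * norm u * norm v"
  shows "min (norm (xhat - xstar)) (norm (xhat + xstar)) \<le> 2 * s / (lam * real n * norm xstar)"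
proof -
  define a b where "a = norm (xhat - xstar)" and "b = norm (xhat + xstar)"
  have pos: "0 < lam * real n * norm xstar" "0 < lam * real n" "0 \<le> a" "0 \<le> b"
    using assms(1-3) by (auto simp: a_def b_def)
  have "2 * norm xstar = norm ((xhat + xstar) - (xhat - xstar))"
    by (simp flip: scaleR_2)
  also have "\<dots> \<le> b + a"
    unfolding a_def b_def by (rule norm_triangle_ineq4)
  finally have large: "norm xstar \<le> max a b" by linarith
  let ?q = "\<lambda>i. (xhat - xstar) \<bullet> (A i *v (xhat + xstar))"
  have "lam * a\<^sup>2 * b\<^sup>2 \<le> 1 / real n * (\<Sum>i=1..n. (?q i)\<^sup>2)"
    unfolding a_def b_def by (rule lower)
  then have "lam * real n * (a * b)\<^sup>2 \<le> (\<Sum>i=1..n. (?q i)\<^sup>2)"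
    using \<open>1 \<le> n\<close> by (simp add: field_simps power_mult_distrib)
  also have "\<dots> \<le> 2 * (\<Sum>i=1..n. eps i * ?q i)"
    by (rule minimizer_basic_inequality[OF \<open>1 \<le> n\<close> sym min])
  also have "\<dots> \<le> 2 * (s * a * b)"
    using noise[of "xhat - xstar" "xhat + xstar"] unfolding a_def b_def by linarith
  finally have quad: "(lam * real n * (a * b)) * (a * b) \<le> (2 * s) * (a * b)"
    by (simp add: power2_eq_square mult_ac)
  have prod: "lam * real n * (a * b) \<le> 2 * s"
  proof (cases "a * b = 0")
    case True
    then show ?thesis using \<open>0 \<le> s\<close> by (simp only: mult_zero_right)
  next
    case False
    moreover have "0 \<le> a * b" using pos by simp
    ultimately have "0 < a * b" by linarith
    with quad show ?thesis by (rule mult_right_le_imp_le)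
  qed
  have "min a b * norm xstar \<le> min a b * max a b"
    using large pos by (intro mult_left_mono) auto
  also have "\<dots> = a * b" by (cases "a \<le> b") simp_all
  finally have "lam * real n * (min a b * norm xstar) \<le> lam * real n * (a * b)"
    using pos(2) by (intro mult_left_mono) auto
  also note prod
  finally have "lam * real n * (min a b * norm xstar) \<le> 2 * s" .
  then have "min a b * (lam * real n * norm xstar) \<le> 2 * s"
    by (simp only: mult_ac)
  then show ?thesis
    using pos(1) by (simp add: pos_le_divide_eq a_def b_def)
qed

section \<open>Uniform control of the noise form\<close>

text \<open>There are at most \<open>(1 + 2 * n) ^ (2 * CARD('p))\<close> pairs of net points, and
  the threshold is chosen so that each of them fails with probability at most
  \<open>2 * (1 + 2 * n) powr (- 3 * CARD('p))\<close>.\<close>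

lemma (in prob_space) noise_form_bound_many:
  fixes A :: "nat \<Rightarrow> real^'p^'p"
  assumes "4 \<le> n" "0 < eta" "0 < v"
    and indep: "indep_vars (\<lambda>_. borel) eps {1..n}"
    and sg: "\<And>i. i \<in> {1..n} \<Longrightarrow> sub_gaussian M (eps i) v"
    and upper: "\<And>u v. 1 / real n * (\<Sum>i=1..n. (u \<bullet> (A i *v v))\<^sup>2) \<le> eta * (norm u)\<^sup>2 * (norm v)\<^sup>2"
  defines "L \<equiv> real CARD('p) * ln (1 + 2 * real n)"
  shows "\<exists>E\<in>events. 1 - 2 * exp (- L) \<le> prob E \<and>
    (\<forall>\<omega>\<in>E. \<forall>u v'. \<bar>\<Sum>i=1..n. eps i \<omega> * (u \<bullet> (A i *v v'))\<bar>
      \<le> 2 * sqrt (6 * v * eta * real n * L) * norm u * norm v')"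
proof -
  define t where "t = sqrt (6 * v * eta * real n * L)"
  have "0 \<le> L" by (simp add: L_def)
  then have t: "0 \<le> t" "t\<^sup>2 = 6 * v * eta * real n * L"
    using assms(1-3) by (simp_all add: t_def)
  obtain N :: "(real^'p) set" where N: "finite N" "N \<subseteq> sphere 0 1"
    "real (card N) \<le> (1 + 2 / (1 / 4)) ^ DIM(real^'p)"
    "\<And>x. norm x = 1 \<Longrightarrow> \<exists>y\<in>N. dist x y < 1 / 4"
    using sphere_net_exists[of "1 / 4 :: real"] by (metis zero_less_divide_1_iff zero_less_numeral)
  have "real (card N) \<le> 9 ^ CARD('p)" using N(3) by simp
  also have "\<dots> \<le> (1 + 2 * real n) ^ CARD('p)"
    using \<open>4 \<le> n\<close> by (intro power_mono) auto
  also have "\<dots> = exp L"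
    by (simp add: L_def exp_of_nat_mult)
  finally have cardN: "real (card N) \<le> exp L" .
  define Z where "Z = (\<lambda>(x, y) \<omega>. \<Sum>i=1..n. (x \<bullet> (A i *v y)) * eps i \<omega>)"
  define E where "E = {\<omega> \<in> space M. \<forall>p\<in>N \<times> N. \<bar>Z p \<omega>\<bar> \<le> t}"
  have "sub_gaussian M (Z p) (v * (eta * real n))" if "p \<in> N \<times> N" for p
  proof -
    obtain x y where p: "p = (x, y)" "norm x = 1" "norm y = 1"
      using \<open>p \<in> N \<times> N\<close> N(2) by (auto simp: subset_iff)
    have "(\<Sum>i=1..n. (x \<bullet> (A i *v y))\<^sup>2) \<le> eta * real n"
      using upper[of x y] p \<open>4 \<le> n\<close> by (simp add: field_simps)
    then show ?thesis
      unfolding Z_def p(1) prod.case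
      by (intro sub_gaussian_mono[OF sub_gaussian_linear_combination[OF _ indep sg]])
        (use \<open>0 < v\<close> in auto)
  qed
  then have E: "E \<in> events"
    "1 - real (card (N \<times> N)) * (2 * exp (- (t\<^sup>2 / (2 * (v * (eta * real n)))))) \<le> prob E"
    using sub_gaussian_union_bound[of "N \<times> N" Z "v * (eta * real n)" t] N(1) t(1) assms(1-3)
    unfolding E_def by auto
  have "t\<^sup>2 / (2 * (v * (eta * real n))) = 3 * L"
    using assms(1-3) unfolding t(2) by (simp add: field_simps)
  moreover have "real (card (N \<times> N)) * (2 * exp (- (3 * L))) \<le> (exp L * exp L) * (2 * exp (- (3 * L)))"
    using cardN by (intro mult_right_mono) (auto simp: card_cartesian_product intro!: mult_mono)
  moreover have "(exp L * exp L) * (2 * exp (- (3 * L))) = 2 * exp (- L)"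
    by (simp flip: exp_add)
  ultimately have "1 - 2 * exp (- L) \<le> prob E"
    using E(2) by simp
  moreover have "\<bar>\<Sum>i=1..n. eps i \<omega> * (u \<bullet> (A i *v v'))\<bar> \<le> 2 * t * norm u * norm v'"
    if "\<omega> \<in> E" for \<omega> u v'
  proof -
    define B where "B = (\<Sum>i=1..n. eps i \<omega> *\<^sub>R A i)"
    have B: "(\<Sum>i=1..n. eps i \<omega> * (x \<bullet> (A i *v y))) = x \<bullet> (B *v y)" for x y
      unfolding B_def
      by (induction n)
        (auto simp: matrix_vector_mult_add_rdistrib inner_add_right scaleR_matrix_vector_assoc[symmetric])
    have "bounded_bilinear (\<lambda>x y. x \<bullet> (B *v y))"
      using bounded_bilinear.comp[OF bounded_bilinear_inner bounded_linear_ident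
          matrix_vector_mul_bounded_linear] .
    moreover have "\<bar>x \<bullet> (B *v y)\<bar> \<le> t" if "x \<in> N" "y \<in> N" for x y
      using \<open>\<omega> \<in> E\<close> that by (auto simp: E_def Z_def B[symmetric] mult.commute)
    ultimately show ?thesis
      unfolding B using N by (intro bilinear_le_of_net[of _ N]) auto
  qed
  ultimately show ?thesis
    using E(1) unfolding t_def by blast
qed

text \<open>The event is that all \<open>(eps i)\<^sup>2\<close> are at most \<open>8 * v * L\<close>. Then
  \<open>(\<Sum>i=1..n. (eps i)\<^sup>2) \<le> 24 * v * L\<close>, which is exactly what Cauchy-Schwarz needs. The union bound
  costs a factor \<open>n \<le> 1 + 2 * n \<le> exp L\<close>, and each variable fails with probability at most
  \<open>2 * exp (- 4 * L)\<close>.\<close>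

lemma (in prob_space) noise_form_bound_few:
  fixes A :: "nat \<Rightarrow> real^'p^'p"
  assumes "1 \<le> n" "n \<le> 3" "0 < eta" "0 < v"
    and sg: "\<And>i. i \<in> {1..n} \<Longrightarrow> sub_gaussian M (eps i) v"
    and upper: "\<And>u v. 1 / real n * (\<Sum>i=1..n. (u \<bullet> (A i *v v))\<^sup>2) \<le> eta * (norm u)\<^sup>2 * (norm v)\<^sup>2"
  defines "L \<equiv> real CARD('p) * ln (1 + 2 * real n)"
  shows "\<exists>E\<in>events. 1 - 2 * exp (- L) \<le> prob E \<and>
    (\<forall>\<omega>\<in>E. \<forall>u v'. \<bar>\<Sum>i=1..n. eps i \<omega> * (u \<bullet> (A i *v v'))\<bar>
      \<le> 2 * sqrt (6 * v * eta * real n * L) * norm u * norm v')"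
proof -
  define r where "r = sqrt (8 * v * L)"
  have "0 \<le> L" by (simp add: L_def)
  then have r: "0 \<le> r" "r\<^sup>2 = 8 * v * L"
    using \<open>0 < v\<close> by (simp_all add: r_def)
  have "1 * ln (1 + 2 * real n) \<le> L"
    unfolding L_def by (intro mult_right_mono) (auto simp: Suc_leI)
  then have "exp (ln (1 + 2 * real n)) \<le> exp L" by (simp only: exp_le_cancel_iff mult_1)
  then have n: "real n \<le> exp L" by simp
  define E where "E = {\<omega> \<in> space M. \<forall>i\<in>{1..n}. \<bar>eps i \<omega>\<bar> \<le> r}"
  have E: "E \<in> events" "1 - real n * (2 * exp (- (r\<^sup>2 / (2 * v)))) \<le> prob E"
    using sub_gaussian_union_bound[of "{1..n}" eps v r, OF _ sg \<open>0 < v\<close> r(1)]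
    unfolding E_def by simp_all
  have "r\<^sup>2 / (2 * v) = 4 * L"
    using \<open>0 < v\<close> unfolding r(2) by simp
  moreover have "real n * (2 * exp (- (4 * L))) \<le> exp L * (2 * exp (- (4 * L)))"
    using n by (intro mult_right_mono) auto
  moreover have "exp L * (2 * exp (- (4 * L))) = 2 * exp (- (3 * L))"
    by (simp flip: exp_add)
  moreover have "exp (- (3 * L)) \<le> exp (- L)"
    using \<open>0 \<le> L\<close> by simp
  ultimately have "1 - 2 * exp (- L) \<le> prob E"
    using E(2) by (simp only:)
  moreover have "\<bar>\<Sum>i=1..n. eps i \<omega> * (u \<bullet> (A i *v v'))\<bar>
      \<le> 2 * sqrt (6 * v * eta * real n * L) * norm u * norm v'" if "\<omega> \<in> E" for \<omega> u v'
  proof (rule power2_le_imp_le)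
    have "(eps i \<omega>)\<^sup>2 \<le> 8 * v * L" if "i \<in> {1..n}" for i
      using \<open>\<omega> \<in> E\<close> that power_mono[of "\<bar>eps i \<omega>\<bar>" r 2] r by (auto simp: E_def)
    then have "(\<Sum>i=1..n. (eps i \<omega>)\<^sup>2) \<le> real n * (8 * v * L)"
      using sum_bounded_above[of "{1..n}" "\<lambda>i. (eps i \<omega>)\<^sup>2" "8 * v * L"] by simp
    also have "\<dots> \<le> 3 * (8 * v * L)"
      using \<open>n \<le> 3\<close> \<open>0 < v\<close> \<open>0 \<le> L\<close> by (intro mult_right_mono) auto
    finally have noise: "(\<Sum>i=1..n. (eps i \<omega>)\<^sup>2) \<le> 24 * v * L" by simp
    have forms: "(\<Sum>i=1..n. (u \<bullet> (A i *v v'))\<^sup>2) \<le> real n * (eta * (norm u)\<^sup>2 * (norm v')\<^sup>2)"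
      using upper[of u v'] \<open>1 \<le> n\<close> by (simp add: field_simps)
    have "\<bar>\<Sum>i=1..n. eps i \<omega> * (u \<bullet> (A i *v v'))\<bar>\<^sup>2
        \<le> (\<Sum>i=1..n. (eps i \<omega>)\<^sup>2) * (\<Sum>i=1..n. (u \<bullet> (A i *v v'))\<^sup>2)"
      by (simp add: Cauchy_Schwarz_ineq_sum)
    also have "\<dots> \<le> (24 * v * L) * (real n * (eta * (norm u)\<^sup>2 * (norm v')\<^sup>2))"
      using noise forms \<open>0 < v\<close> \<open>0 \<le> L\<close> by (intro mult_mono) (auto intro: sum_nonneg)
    also have "\<dots> = (2 * sqrt (6 * v * eta * real n * L) * norm u * norm v')\<^sup>2"
      using assms(3,4) \<open>0 \<le> L\<close> by (simp add: power_mult_distrib)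
    finally show "\<bar>\<Sum>i=1..n. eps i \<omega> * (u \<bullet> (A i *v v'))\<bar>\<^sup>2
      \<le> (2 * sqrt (6 * v * eta * real n * L) * norm u * norm v')\<^sup>2" .
  qed (use assms(3,4) \<open>0 \<le> L\<close> in simp)
  ultimately show ?thesis
    using E(1) by blast
qed

section \<open>Recovery of the signal\<close>

theorem theorem3p1:
  fixes A :: "nat \<Rightarrow> real^'p^'p" and xstar :: "real^'p"
    and n :: nat and lam eta :: real
  assumes "1 \<le> n" and "0 < lam" and "0 < eta"
    and "\<And>i. i \<in> {1..n} \<Longrightarrow> transpose (A i) = A i"
    and "\<And>u v. lam * (norm u)\<^sup>2 * (norm v)\<^sup>2 \<le> 1 / real n * (\<Sum>i=1..n. (u \<bullet> (A i *v v))\<^sup>2)"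
    and "\<And>u v. 1 / real n * (\<Sum>i=1..n. (u \<bullet> (A i *v v))\<^sup>2) \<le> eta * (norm u)\<^sup>2 * (norm v)\<^sup>2"
    and "xstar \<noteq> 0"
  shows
    "(\<forall>eps xhat. (\<forall>i\<in>{1..n}. eps i = 0) \<longrightarrow>
        is_arg_min (objective n A (observations A xstar eps)) (\<lambda>_. True) xhat \<longrightarrow>
        xhat = xstar \<or> xhat = - xstar)
     \<and>
     (\<forall>(M :: 'w measure) (eps :: nat \<Rightarrow> 'w \<Rightarrow> real) (sig :: real).
        prob_space M \<longrightarrow>
        prob_space.indep_vars M (\<lambda>_. borel) eps {1..n} \<longrightarrow>
        (\<forall>i\<in>{1..n}. distr M borel (eps i) = distr M borel (eps 1)) \<longrightarrow>
        0 < sig\<^sup>2 \<longrightarrow>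
        (\<forall>i\<in>{1..n}. sub_gaussian M (eps i) (sig\<^sup>2)) \<longrightarrow>
        0 < (\<integral>\<omega>. (eps 1 \<omega>)\<^sup>2 \<partial>M) \<longrightarrow>
        (\<exists>E\<in>sets M.
           measure M E \<ge> 1
             - 2 * exp (- (real CARD('p) * ln (1 + 2 * real n)))
             - 2 * exp (- (real n * (\<integral>\<omega>. (eps 1 \<omega>)\<^sup>2 \<partial>M) / (512 * sig\<^sup>2))) \<and>
           (\<forall>\<omega>\<in>E. \<forall>xhat.
              is_arg_min (objective n A (observations A xstar (\<lambda>i. eps i \<omega>))) (\<lambda>_. True) xhat \<longrightarrow>
              min (norm (xhat - xstar)) (norm (xhat + xstar))
                \<le> 4 / (lam * norm xstar)
                   * sqrt (6 * sig\<^sup>2 * eta * real CARD('p) * ln (1 + 2 * real n) / real n))))"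
proof (intro conjI allI impI)
  fix eps :: "nat \<Rightarrow> real" and xhat
  assume "\<forall>i\<in>{1..n}. eps i = 0"
    and min: "is_arg_min (objective n A (observations A xstar eps)) (\<lambda>_. True) xhat"
  then have "\<bar>\<Sum>i=1..n. eps i * (u \<bullet> (A i *v v))\<bar> \<le> 0 * norm u * norm v" for u v
    by simp
  from minimizer_error_le[OF assms(1,2,7) order_refl assms(4,5) min this]
  have "min (norm (xhat - xstar)) (norm (xhat + xstar)) \<le> 0" by simp
  then show "xhat = xstar \<or> xhat = - xstar"
    by (auto simp: min_le_iff_disj eq_neg_iff_add_eq_0)
next
  fix M :: "'w measure" and eps :: "nat \<Rightarrow> 'w \<Rightarrow> real" and sig :: real
  assume "prob_space M" and indep: "prob_space.indep_vars M (\<lambda>_. borel) eps {1..n}"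
    and sig: "0 < sig\<^sup>2" and sg: "\<forall>i\<in>{1..n}. sub_gaussian M (eps i) (sig\<^sup>2)"
  interpret prob_space M by fact
  define L where "L = real CARD('p) * ln (1 + 2 * real n)"
  define s where "s = 2 * sqrt (6 * sig\<^sup>2 * eta * real n * L)"
  have "\<exists>E\<in>events. 1 - 2 * exp (- L) \<le> prob E \<and>
      (\<forall>\<omega>\<in>E. \<forall>u v. \<bar>\<Sum>i=1..n. eps i \<omega> * (u \<bullet> (A i *v v))\<bar> \<le> s * norm u * norm v)"
  proof (cases "4 \<le> n")
    case True
    then show ?thesis
      unfolding s_def L_def
      by (intro noise_form_bound_many) (use assms(3,6) indep sig sg in auto)
  next
    case False
    then show ?thesis
      unfolding s_def L_def
      by (intro noise_form_bound_few) (use assms(1,3,6) sig sg in auto)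
  qed
  then obtain E where E: "E \<in> events" "1 - 2 * exp (- L) \<le> prob E"
    "\<And>\<omega> u v. \<omega> \<in> E \<Longrightarrow> \<bar>\<Sum>i=1..n. eps i \<omega> * (u \<bullet> (A i *v v))\<bar> \<le> s * norm u * norm v"
    by blast
  have "0 \<le> L" by (simp add: L_def)
  then have "0 \<le> s" using assms(3) by (simp add: s_def)
  have "6 * sig\<^sup>2 * eta * real n * L = (real n)\<^sup>2 * (6 * sig\<^sup>2 * eta * L / real n)"
    using assms(1) by (simp add: power2_eq_square)
  then have "s = 2 * (real n * sqrt (6 * sig\<^sup>2 * eta * L / real n))"
    by (simp only: s_def real_sqrt_mult) simp
  then have bound: "2 * s / (lam * real n * norm xstar)
      = 4 / (lam * norm xstar) * sqrt (6 * sig\<^sup>2 * eta * L / real n)"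
    using assms(1) by (simp add: field_simps)
  show "\<exists>E\<in>sets M.
      measure M E \<ge> 1 - 2 * exp (- (real CARD('p) * ln (1 + 2 * real n)))
        - 2 * exp (- (real n * (\<integral>\<omega>. (eps 1 \<omega>)\<^sup>2 \<partial>M) / (512 * sig\<^sup>2))) \<and>
      (\<forall>\<omega>\<in>E. \<forall>xhat.
        is_arg_min (objective n A (observations A xstar (\<lambda>i. eps i \<omega>))) (\<lambda>_. True) xhat \<longrightarrow>
        min (norm (xhat - xstar)) (norm (xhat + xstar))
          \<le> 4 / (lam * norm xstar)
            * sqrt (6 * sig\<^sup>2 * eta * real CARD('p) * ln (1 + 2 * real n) / real n))"
  proof (intro bexI[OF _ E(1)] conjI ballI allI impI)
    show "measure M E \<ge> 1 - 2 * exp (- (real CARD('p) * ln (1 + 2 * real n)))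
        - 2 * exp (- (real n * (\<integral>\<omega>. (eps 1 \<omega>)\<^sup>2 \<partial>M) / (512 * sig\<^sup>2)))"
      using E(2) unfolding L_def by (smt (verit) exp_ge_zero)
  next
    fix \<omega> xhat
    assume "\<omega> \<in> E"
      and "is_arg_min (objective n A (observations A xstar (\<lambda>i. eps i \<omega>))) (\<lambda>_. True) xhat"
    from minimizer_error_le[OF assms(1,2,7) \<open>0 \<le> s\<close> assms(4,5) this(2) E(3)[OF this(1)]]
    show "min (norm (xhat - xstar)) (norm (xhat + xstar))
      \<le> 4 / (lam * norm xstar)
        * sqrt (6 * sig\<^sup>2 * eta * real CARD('p) * ln (1 + 2 * real n) / real n)"
      unfolding bound by (simp add: L_def mult.assoc)
  qed
qed

end
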